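(* Every induced $P_4$ in an edge-transitive graph closes to an induced cycle.
   Context: Graphs are finite, simple, undirected, with non-empty vertex set. $P_4$ denotes the four-vertex path. A graph $G$ is edge-transitive if for any two edges $e,f\in E(G)$ there is an automorphism of $G$ mapping $e$ to $f$. An induced path in $G$ closes to an induced cycle if there is an induced (chordless) cycle of $G$ that contains the path as a subpath. *)

theory Defs
  imports "Graph_Theory.Digraph_Isomorphism"
begin

text \<open>
  A finite simple undirected graph is a \<^locale>\<open>pair_graph\<close>: an edge between
  \<open>u\<close> and \<open>v\<close> is the pair of opposite arcs \<open>(u, v)\<close>, \<open>(v, u)\<close>.
\<close>

definition path_graph :: "nat \<Rightarrow> nat pair_pre_digraph" where
  "path_graph n = \<lparr> pverts = {..<n},
     parcs = {(i, j). i < n \<and> j < n \<and> (j = Suc i \<or> i = Suc j)} \<rparr>"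

text \<open>Only meaningful for \<open>n \<ge> 3\<close>.\<close>
definition cycle_graph :: "nat \<Rightarrow> nat pair_pre_digraph" where
  "cycle_graph n = \<lparr> pverts = {..<n},
     parcs = {(i, j). i < n \<and> j < n \<and> (j = Suc i mod n \<or> i = Suc j mod n)} \<rparr>"

lemma pair_graph_path_graph: "pair_graph (path_graph n)"
proof
  have "parcs (path_graph n) \<subseteq> {..<n} \<times> {..<n}" by (auto simp: path_graph_def)
  then show "finite (parcs (path_graph n))" by (rule finite_subset) simp
qed (auto simp: path_graph_def symmetric_def sym_def)

lemma pair_graph_cycle_graph:
  assumes "n \<ge> 3"
  shows "pair_graph (cycle_graph n)"
proof
  have "parcs (cycle_graph n) \<subseteq> {..<n} \<times> {..<n}" by (auto simp: cycle_graph_def)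
  then show "finite (parcs (cycle_graph n))" by (rule finite_subset) simp
qed (use assms in \<open>auto simp: cycle_graph_def symmetric_def sym_def mod_Suc split: if_splits\<close>)

definition induced_path :: "nat \<Rightarrow> 'a pair_pre_digraph \<Rightarrow> 'a pair_pre_digraph \<Rightarrow> bool" where
  "induced_path n P G \<longleftrightarrow> induced_subgraph (with_proj P) (with_proj G) \<and>
     digraph_iso (with_proj P) (with_proj (path_graph n))"

definition induced_cycle :: "'a pair_pre_digraph \<Rightarrow> 'a pair_pre_digraph \<Rightarrow> bool" where
  "induced_cycle C G \<longleftrightarrow> induced_subgraph (with_proj C) (with_proj G) \<and>
     (\<exists>n\<ge>3. digraph_iso (with_proj C) (with_proj (cycle_graph n)))"

text \<open>A path that is a subgraph of a cycle is a subpath of that cycle.\<close>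
definition closes_to_induced_cycle ::
    "'a pair_pre_digraph \<Rightarrow> 'a pair_pre_digraph \<Rightarrow> bool" where
  "closes_to_induced_cycle P G \<longleftrightarrow>
     (\<exists>C. induced_cycle C G \<and> subgraph (with_proj P) (with_proj C))"

definition automorphism ::
    "'a pair_pre_digraph \<Rightarrow> ('a, 'a \<times> 'a, 'a, 'a \<times> 'a) digraph_isomorphism \<Rightarrow> bool" where
  "automorphism G h \<longleftrightarrow> pre_digraph.digraph_isomorphism (with_proj G) h \<and>
     app_iso h (with_proj G) = with_proj G"

text \<open>
  Edges are compared as unordered pairs: an automorphism may reverse the orientation,
  so this is edge-transitivity and not the stronger arc-transitivity.
\<close>
definition edge_transitive :: "'a pair_pre_digraph \<Rightarrow> bool" where
  "edge_transitive G \<longleftrightarrow> (\<forall>(u, v) \<in> parcs G. \<forall>(x, y) \<in> parcs G.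
     \<exists>h. automorphism G h \<and> {iso_verts h u, iso_verts h v} = {x, y})"

end

theory Submission
  imports Defs
begin

text \<open>
  Call an edge \<open>xy\<close> avoidable if every induced \<open>a - x - y - b\<close> closes to an induced cycle. Since
  automorphisms preserve avoidability, it suffices that every finite graph with an edge has an
  avoidable one. Suppose some induced \<open>P\<^sub>4\<close> exists, and let \<open>U\<close> be a maximal connected
  vertex set such that \<open>W = V - N[U]\<close> still spans an edge; the first vertex of a \<open>P\<^sub>4\<close> shows that
  such sets exist. By induction some edge \<open>xy\<close> is avoidable in \<open>G[W]\<close>, and it is avoidable in \<open>G\<close>:
  given \<open>a - x - y - b\<close>, if \<open>a, b \<in> W\<close> the cycle exists in \<open>G[W]\<close>; if \<open>a, b \<in> N(U)\<close>, they are joined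
  through \<open>U\<close>, which has no neighbours in \<open>{x, y}\<close>; and if only \<open>a\<close> is in \<open>N(U)\<close>, then
  \<open>U \<union> {a}\<close> contradicts maximality because of the edge \<open>yb\<close>.
\<close>

text \<open>For an edge \<open>xy\<close> this excludes \<open>x\<close> and \<open>y\<close> themselves.\<close>
definition far :: "'a rel \<Rightarrow> 'a \<Rightarrow> 'a \<Rightarrow> 'a set" where
  "far E x y = {p. (p, x) \<notin> E \<and> (p, y) \<notin> E}"

text \<open>For symmetric \<open>E\<close> these conditions force the four vertices to be distinct.\<close>
definition induced_P4 :: "'a rel \<Rightarrow> 'a \<Rightarrow> 'a \<Rightarrow> 'a \<Rightarrow> 'a \<Rightarrow> bool" where
  "induced_P4 E a x y b \<longleftrightarrow> (a, x) \<in> E \<and> (x, y) \<in> E \<and> (y, b) \<in> E \<and>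
     (a, y) \<notin> E \<and> (x, b) \<notin> E \<and> (a, b) \<notin> E"

text \<open>
  Closing to an induced cycle is replaced by the existence of a walk from \<open>a\<close> to \<open>b\<close> whose inner
  vertices are not adjacent to \<open>x\<close> or \<open>y\<close>; a shortest such walk completes the cycle.
\<close>
definition avoidable :: "'a rel \<Rightarrow> 'a \<Rightarrow> 'a \<Rightarrow> bool" where
  "avoidable E x y \<longleftrightarrow> (x, y) \<in> E \<and>
     (\<forall>a b. induced_P4 E a x y b \<longrightarrow> (a, b) \<in> (Restr E ({a, b} \<union> far E x y))\<^sup>*)"

section \<open>Reversing paths and edges\<close>

lemma far_commute: "far E x y = far E y x"
  by (auto simp: far_def)

lemma induced_P4_rev:
  assumes "sym E" "induced_P4 E a x y b"
  shows "induced_P4 E b y x a"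
  using assms by (auto simp: induced_P4_def dest: symD)

lemma avoidable_commute:
  assumes "sym E" "avoidable E x y"
  shows "avoidable E y x"
  unfolding avoidable_def
proof (intro conjI allI impI)
  show "(y, x) \<in> E" using assms by (auto simp: avoidable_def dest: symD)
  fix a b assume "induced_P4 E a y x b"
  then have "(b, a) \<in> (Restr E ({b, a} \<union> far E x y))\<^sup>*"
    using assms induced_P4_rev by (fastforce simp: avoidable_def)
  moreover have "sym ((Restr E ({b, a} \<union> far E x y))\<^sup>*)"
    using assms(1) by (intro sym_rtrancl) (auto simp: sym_def)
  ultimately have "(a, b) \<in> (Restr E ({b, a} \<union> far E x y))\<^sup>*" by (blast dest: symD)
  then show "(a, b) \<in> (Restr E ({a, b} \<union> far E y x))\<^sup>*"
    by (simp add: far_commute insert_commute)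
qed

section \<open>Existence of an avoidable edge\<close>

text \<open>The graph is a bare relation with its vertices implicit in \<open>Field E\<close>, so
  that the induction on the number of arcs can pass directly to
  \<open>Restr E (R U)\<close>.\<close>

lemma avoidable_edge_exists:
  assumes "finite E" "sym E" "E \<noteq> {}"
  shows "\<exists>x y. avoidable E x y"
  using assms
proof (induction "card E" arbitrary: E rule: less_induct)
  case less
  note symE = \<open>sym E\<close>
  \<comment> \<open>\<open>R U\<close> plays the role of \<open>W\<close>, taken in the whole type:
    points outside \<open>Field E\<close> carry no arcs.\<close>
  define R where "R U = - (U \<union> E `` U)" for U
  define Q where "Q U \<longleftrightarrow> U \<noteq> {} \<and> (\<forall>p\<in>U. \<forall>q\<in>U. (p, q) \<in> (Restr E U)\<^sup>*) \<and>
    Restr E (R U) \<noteq> {}" for U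
  show ?case
  proof (cases "\<exists>a x y b. induced_P4 E a x y b")
    case False
    then show ?thesis using \<open>E \<noteq> {}\<close> by (auto simp: avoidable_def)
  next
    case True
    then obtain a x y b where P: "induced_P4 E a x y b" by blast
    then have "(y, b) \<in> Restr E (R {a})"
      using symE by (auto simp: induced_P4_def R_def dest: symD)
    then have "Q {a}" by (auto simp: Q_def)
    moreover have "a \<in> Field E" using P by (auto simp: induced_P4_def Field_def)
    ultimately have "{U. U \<subseteq> Field E \<and> Q U} \<noteq> {}" by blast
    moreover have "finite {U. U \<subseteq> Field E \<and> Q U}"
      using \<open>finite E\<close> by (auto simp: finite_Field intro: finite_subset[of _ "Pow (Field E)"])
    ultimately obtain U where UF: "U \<subseteq> Field E" and "Q U"
      and max: "\<And>U'. U' \<subseteq> Field E \<Longrightarrow> Q U' \<Longrightarrow> U \<subseteq> U' \<Longrightarrow> U = U'"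
      using finite_has_maximal[of "{U. U \<subseteq> Field E \<and> Q U}"] by auto
    then have conn: "\<And>p q. p \<in> U \<Longrightarrow> q \<in> U \<Longrightarrow> (p, q) \<in> (Restr E U)\<^sup>*"
      and F_ne: "Restr E (R U) \<noteq> {}" and "U \<noteq> {}"
      by (auto simp: Q_def)
    define F where "F = Restr E (R U)"
    \<comment> \<open>An arc starting in \<open>U\<close> is lost in \<open>F\<close>, which gives
      the strict decrease for the induction.\<close>
    obtain u v where "u \<in> U" "(u, v) \<in> E"
      using \<open>U \<noteq> {}\<close> UF symE by (force simp: Field_def dest: symD)
    then have "F \<subset> E" by (auto simp: F_def R_def)
    then have "card F < card E" using \<open>finite E\<close> by (rule psubset_card_mono[rotated])
    moreover have "finite F" "sym F" "F \<noteq> {}"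
      using \<open>finite E\<close> symE F_ne by (auto simp: F_def sym_def)
    ultimately obtain x y where av: "avoidable F x y" using less.hyps by blast
    then have xy: "(x, y) \<in> E" "x \<in> R U" "y \<in> R U" by (auto simp: avoidable_def F_def)
    \<comment> \<open>By maximality a neighbour \<open>c\<close> of \<open>U\<close> sees an end of
      every edge left in \<open>R U\<close>: otherwise adding \<open>c\<close> to \<open>U\<close>
      keeps it connected and spares the edge \<open>pq\<close>.\<close>
    have dom: "(c, p) \<in> E \<or> (c, q) \<in> E"
      if c: "c \<in> E `` U" "c \<notin> U" and pq: "(p, q) \<in> E" "p \<in> R U" "q \<in> R U" for c p q
    proof (rule ccontr)
      assume no: "\<not> ?thesis"
      obtain w where w: "w \<in> U" "(w, c) \<in> E" using c by blast
      let ?T = "(Restr E (insert c U))\<^sup>*"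
      have "(w, c) \<in> ?T" "(c, w) \<in> ?T"
        using w symD[OF symE w(2)] by (blast intro: r_into_rtrancl)+
      moreover have "(p, w) \<in> ?T" "(w, p) \<in> ?T" if "p \<in> U" for p
        using conn[OF that w(1)] conn[OF w(1) that]
        by (auto intro: rtrancl_mono[THEN subsetD, rotated])
      ultimately have "(p, w) \<in> ?T" "(w, p) \<in> ?T" if "p \<in> insert c U" for p
        using that by blast+
      then have "\<forall>p\<in>insert c U. \<forall>q\<in>insert c U. (p, q) \<in> ?T"
        by (meson rtrancl_trans)
      moreover have "(p, q) \<in> Restr E (R (insert c U))"
        using pq no symE by (auto simp: R_def dest: symD)
      ultimately have "Q (insert c U)" by (auto simp: Q_def)
      moreover have "insert c U \<subseteq> Field E" using UF w by (auto simp: Field_def)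
      ultimately show False using max[of "insert c U"] c by auto
    qed
    have "avoidable E x y"
      unfolding avoidable_def
    proof (intro conjI allI impI)
      show "(x, y) \<in> E" by fact
      fix a b assume P: "induced_P4 E a x y b"
      let ?S = "Restr E ({a, b} \<union> far E x y)"
      have E: "(a, x) \<in> E" "(b, y) \<in> E" "(x, a) \<in> E" "(y, b) \<in> E"
        using P symE by (auto simp: induced_P4_def dest: symD)
      then have notU: "a \<notin> U" "b \<notin> U" using xy by (auto simp: R_def)
      \<comment> \<open>In the mixed case \<open>dom\<close>, applied to the edge \<open>yb\<close>
        or \<open>xa\<close>, would produce a chord of the induced path.\<close>
      have R: "a \<in> R U \<longleftrightarrow> b \<in> R U"
        using dom[of a y b] dom[of b x a] P notU E xy symE
        by (auto simp: R_def induced_P4_def dest: symD)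
      show "(a, b) \<in> ?S\<^sup>*"
      proof (cases "a \<in> R U")
        case True
        then have "induced_P4 F a x y b" using P R xy by (auto simp: induced_P4_def F_def)
        then have "(a, b) \<in> (Restr F ({a, b} \<union> far F x y))\<^sup>*" using av by (auto simp: avoidable_def)
        \<comment> \<open>Inside \<open>R U\<close>, which contains \<open>x\<close> and
          \<open>y\<close>, adjacency to these two is the same in \<open>F\<close> and in
          \<open>E\<close>, so the walk stays admissible.\<close>
        then show ?thesis
          by (rule rtrancl_mono[THEN subsetD, rotated]) (use xy in \<open>auto simp: F_def far_def\<close>)
      next
        case False
        then obtain u v where uv: "u \<in> U" "v \<in> U" "(u, a) \<in> E" "(v, b) \<in> E"
          using R notU by (auto simp: R_def)
        \<comment> \<open>Since \<open>x\<close> and \<open>y\<close> lie outside the closed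
          neighbourhood of \<open>U\<close>, a detour through \<open>U\<close> is
          admissible.\<close>
        have "U \<subseteq> far E x y" using xy by (auto simp: far_def R_def)
        then have "Restr E U \<subseteq> ?S" by blast
        then have "(u, v) \<in> ?S\<^sup>*" using conn[OF uv(1,2)] rtrancl_mono by blast
        moreover have "(a, u) \<in> ?S" "(v, b) \<in> ?S"
          using uv symD[OF symE uv(3)] \<open>U \<subseteq> far E x y\<close> by auto
        ultimately show ?thesis by (meson converse_rtrancl_into_rtrancl rtrancl_into_rtrancl)
      qed
    qed
    then show ?thesis by blast
  qed
qed

section \<open>Transport along automorphisms\<close>

text \<open>The walk supplied for the image edge is pulled back arc by arc along
  \<open>inv_into V h\<close>; its vertices lie in \<open>V\<close> because both ends of every arc
  do.\<close>

lemma avoidable_automorphism: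
  assumes bij: "bij_betw h V V" and E: "E \<subseteq> V \<times> V"
    and h: "\<And>p q. p \<in> V \<Longrightarrow> q \<in> V \<Longrightarrow> (h p, h q) \<in> E \<longleftrightarrow> (p, q) \<in> E"
    and V: "x \<in> V" "y \<in> V" and av: "avoidable E (h x) (h y)"
  shows "avoidable E x y"
  unfolding avoidable_def
proof (intro conjI allI impI)
  show "(x, y) \<in> E" using av h V by (auto simp: avoidable_def)
  fix a b assume P: "induced_P4 E a x y b"
  then have ab: "a \<in> V" "b \<in> V" using E by (auto simp: induced_P4_def)
  let ?g = "inv_into V h"
  let ?S = "Restr E ({h a, h b} \<union> far E (h x) (h y))"
  have "induced_P4 E (h a) (h x) (h y) (h b)" using P h V ab by (simp add: induced_P4_def)
  then have path: "(h a, h b) \<in> ?S\<^sup>*" using av by (auto simp: avoidable_def)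
  have step_arc: "(?g p, ?g q) \<in> Restr E ({a, b} \<union> far E x y)" if pq: "(p, q) \<in> ?S" for p q
  proof -
    have "p \<in> h ` V" "q \<in> h ` V" using pq E bij by (auto simp: bij_betw_def)
    then obtain p' q' where "p = h p'" "q = h q'" "p' \<in> V" "q' \<in> V" by blast
    moreover have "inj_on h V" using bij by (auto simp: bij_betw_def)
    ultimately show ?thesis using pq h V ab by (auto simp: far_def inj_on_eq_iff)
  qed
  from path have "(?g (h a), ?g (h b)) \<in> (Restr E ({a, b} \<union> far E x y))\<^sup>*"
  proof (induction rule: rtrancl_induct)
    case base
    show ?case by (rule rtrancl_refl)
  next
    case (step p q)
    show ?case by (rule rtrancl_into_rtrancl[OF step.IH step_arc[OF step.hyps(2)]])
  qed
  then show "(a, b) \<in> (Restr E ({a, b} \<union> far E x y))\<^sup>*"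
    using ab bij by (simp add: bij_betw_def)
qed

section \<open>From walks to induced cycles\<close>

text \<open>In a walk of least length \<open>m\<close>, a repeated vertex or a forward chord would
  give a shortcut.\<close>

lemma shortest_path_exists:
  assumes "(a, b) \<in> R\<^sup>*"
  obtains f and m :: nat where "f 0 = a" "f m = b" "inj_on f {..m}"
    "\<And>i. i < m \<Longrightarrow> (f i, f (Suc i)) \<in> R"
    "\<And>i j. i < j \<Longrightarrow> j \<le> m \<Longrightarrow> (f i, f j) \<in> R \<longleftrightarrow> j = Suc i"
proof -
  define m where "m = (LEAST k. (a, b) \<in> R ^^ k)"
  have "\<exists>k. (a, b) \<in> R ^^ k" using assms by (simp add: rtrancl_power)
  then have "(a, b) \<in> R ^^ m" unfolding m_def by (rule LeastI_ex)
  then obtain f where f: "f 0 = a" "f m = b" "\<And>i. i < m \<Longrightarrow> (f i, f (Suc i)) \<in> R"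
    by (auto simp: relpow_fun_conv)
  have min: "m \<le> k" if "(a, b) \<in> R ^^ k" for k
    using that unfolding m_def by (rule Least_le)
  have seg: "(f i, f (i + k)) \<in> R ^^ k" if "i + k \<le> m" for i k
    using that f(3) by (auto simp: relpow_fun_conv intro!: exI[of _ "\<lambda>j. f (i + j)"])
  have pre: "(a, f i) \<in> R ^^ i" if "i \<le> m" for i
    using seg[of 0 i] that f by simp
  have post: "(f j, b) \<in> R ^^ (m - j)" if "j \<le> m" for j
    using seg[of j "m - j"] that f by simp
  have inj: "f i \<noteq> f j" if "i < j" "j \<le> m" for i j
  proof
    assume "f i = f j"
    then have "(a, b) \<in> R ^^ (i + (m - j))"
      using pre[of i] post[of j] that unfolding relpow_add by auto
    then show False using min that by fastforce
  qed
  \<comment> \<open>The chord replaces \<open>j - i\<close> steps by one, so minimality forces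
    \<open>j - i\<close> to be at most 1.\<close>
  have "j = Suc i" if "i < j" "j \<le> m" "(f i, f j) \<in> R" for i j
  proof -
    have "(a, b) \<in> R ^^ (Suc i + (m - j))"
      using pre[of i] post[of j] that unfolding relpow_add by auto
    then show ?thesis using min that by fastforce
  qed
  then show thesis
    using that[of f m] f inj by (metis (no_types, lifting) Suc_le_lessD atMost_iff linorder_inj_onI')
qed

text \<open>A shortest admissible walk from \<open>a\<close> to \<open>b\<close>, followed by
  \<open>y\<close> and \<open>x\<close>, is an induced cycle: its inner vertices see neither
  \<open>x\<close> nor \<open>y\<close>.\<close>

lemma induced_cycle_through_P4:
  assumes "sym E" "irrefl E" and P: "induced_P4 E a x y b"
    and conn: "(a, b) \<in> (Restr E ({a, b} \<union> far E x y))\<^sup>*"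
  obtains n :: nat and g where "n \<ge> 3" "inj_on g {..<n}" "{a, x, y, b} \<subseteq> g ` {..<n}"
    "g ` {..<n} \<subseteq> Field E"
    "\<forall>i<n. \<forall>j<n. (g i, g j) \<in> E \<longleftrightarrow> j = Suc i mod n \<or> i = Suc j mod n"
proof -
  let ?S = "Restr E ({a, b} \<union> far E x y)"
  obtain f and m :: nat where f0: "f 0 = a" and fm: "f m = b" and inj: "inj_on f {..m}"
    and step: "\<And>i. i < m \<Longrightarrow> (f i, f (Suc i)) \<in> ?S"
    and short: "\<And>i j. i < j \<Longrightarrow> j \<le> m \<Longrightarrow> (f i, f j) \<in> ?S \<longleftrightarrow> j = Suc i"
    using shortest_path_exists[OF conn] by blast
  have E: "(a, x) \<in> E" "(x, a) \<in> E" "(x, y) \<in> E" "(y, x) \<in> E" "(y, b) \<in> E" "(b, y) \<in> E"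
    "(a, y) \<notin> E" "(y, a) \<notin> E" "(x, b) \<notin> E" "(b, x) \<notin> E" "(a, b) \<notin> E" "(b, a) \<notin> E"
    using P \<open>sym E\<close> by (auto simp: induced_P4_def dest: symD)
  then have "a \<noteq> b" by auto
  then have "m > 0" using f0 fm by (cases m) auto
  have fS: "f i \<in> {a, b} \<union> far E x y" if "i \<le> m" for i
    using step[of i] fm that by (cases "i = m") auto
  have fF: "f i \<in> Field E" if "i \<le> m" for i
    using step[of i] step[of "i - 1"] fm that \<open>m > 0\<close> by (cases "i = m") (auto simp: Field_def)
  \<comment> \<open>All \<open>f i\<close> lie in the set to which \<open>?S\<close> restricts
    \<open>E\<close>, so the walk has no chord in \<open>E\<close> either.\<close>
  have ff: "(f i, f j) \<in> E \<longleftrightarrow> j = Suc i" if "i < j" "j \<le> m" for i j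
    using short[OF that] fS[of i] fS[of j] that by auto
  have fx: "(f i, x) \<in> E \<longleftrightarrow> i = 0" and fy: "(f i, y) \<in> E \<longleftrightarrow> i = m" if "i \<le> m" for i
  proof -
    have "i = 0 \<or> i = m \<or> f i \<in> far E x y"
      using fS[OF that] inj_on_eq_iff[OF inj, of i 0] inj_on_eq_iff[OF inj, of i m] f0 fm that
      by auto
    then show "(f i, x) \<in> E \<longleftrightarrow> i = 0" "(f i, y) \<in> E \<longleftrightarrow> i = m"
      using E f0 fm by (auto simp: far_def)
  qed
  have ne: "f i \<noteq> x" "f i \<noteq> y" if "i \<le> m" for i
    using fx[OF that] fy[OF that] E f0 fm \<open>m > 0\<close> by metis+
  have "x \<noteq> y" using E by auto
  \<comment> \<open>The walk has \<open>m + 1\<close> vertices; \<open>y\<close> and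
    \<open>x\<close> take the indices \<open>m + 1\<close> and \<open>m + 2\<close>.\<close>
  define n where "n = m + 3"
  define g where "g i = (if i \<le> m then f i else if i = Suc m then y else x)" for i
  have "inj_on g {..<n}"
  proof (rule linorder_inj_onI')
    fix i j assume "i \<in> {..<n}" "j \<in> {..<n}" "i < j"
    then show "g i \<noteq> g j"
      using ne[of i] ne[of j] inj_on_eq_iff[OF inj, of i j] \<open>x \<noteq> y\<close> by (auto simp: g_def n_def)
  qed
  moreover have "{a, x, y, b} \<subseteq> g ` {..<n}"
  proof -
    have "g 0 = a" "g (m + 2) = x" "g (m + 1) = y" "g m = b" by (auto simp: g_def f0 fm)
    moreover have "0 < n" "m + 2 < n" "m + 1 < n" "m < n" by (auto simp: n_def)
    ultimately show ?thesis by (metis image_eqI insert_subset lessThan_iff empty_subsetI)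
  qed
  moreover have "g ` {..<n} \<subseteq> Field E"
    using fF E by (auto simp: g_def Field_def)
  \<comment> \<open>The pair \<open>0\<close>, \<open>m + 2\<close> is the closing edge
    \<open>ax\<close>, which becomes the wrap-around case modulo \<open>n\<close>.\<close>
  moreover have adj: "(g i, g j) \<in> E \<longleftrightarrow> j = Suc i \<or> i = 0 \<and> j = m + 2" if ij: "i < j" "j < n" for i j
  proof -
    consider "j \<le> m" | "j = Suc m" | "j = Suc (Suc m)" using ij unfolding n_def by linarith
    then show ?thesis
      by cases (use ij ff[of i j] fx[of i] fy[of i] E in \<open>auto simp: g_def\<close>)
  qed
  have "(g i, g j) \<in> E \<longleftrightarrow> j = Suc i mod n \<or> i = Suc j mod n" if "i < n" "j < n" for i j
  proof -
    have *: "j = Suc i \<or> i = 0 \<and> j = m + 2 \<longleftrightarrow> j = Suc i mod n \<or> i = Suc j mod n"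
      if "i < j" "j < n" for i j
      using that by (auto simp: n_def mod_Suc)
    consider "i < j" | "j < i" | "i = j" by linarith
    then show ?thesis
    proof cases
      case 1
      then show ?thesis using adj * that by simp
    next
      case 2
      then have "(g j, g i) \<in> E \<longleftrightarrow> i = Suc j mod n \<or> j = Suc i mod n" using adj * that by simp
      then show ?thesis using \<open>sym E\<close> by (auto dest: symD)
    next
      case 3
      moreover have "i \<noteq> Suc i mod n" using that by (auto simp: mod_Suc n_def)
      ultimately show ?thesis using \<open>irrefl E\<close> by (auto simp: irrefl_def)
    qed
  qed
  ultimately show thesis using that[of n g] by (simp add: n_def)
qed

section \<open>Digraph isomorphisms as vertex bijections\<close>

text \<open>With \<open>fst\<close> and \<open>snd\<close> as tail and head on both sides, the
  separate arc map of an isomorphism is determined by its vertex map.\<close>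

lemma with_proj_isomorphismD:
  assumes iso: "pre_digraph.digraph_isomorphism (with_proj G) f"
    and app: "app_iso f (with_proj G) = with_proj H"
  shows "bij_betw (iso_verts f) (pverts G) (pverts H)"
    and "\<And>u v. u \<in> pverts G \<Longrightarrow> v \<in> pverts G \<Longrightarrow>
      (iso_verts f u, iso_verts f v) \<in> parcs H \<longleftrightarrow> (u, v) \<in> parcs G"
proof -
  have inj: "inj_on (iso_verts f) (pverts G)"
    using iso by (simp add: pre_digraph.digraph_isomorphism_def)
  have eqs: "iso_verts f ` pverts G = pverts H" "iso_arcs f ` parcs G = parcs H"
    "iso_tail f = fst" "iso_head f = snd"
    using app by (auto simp: app_iso_def with_proj_def)
  show "bij_betw (iso_verts f) (pverts G) (pverts H)" using inj eqs by (simp add: bij_betw_def)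
  have wf: "u \<in> pverts G \<and> v \<in> pverts G" if "(u, v) \<in> parcs G" for u v
    using iso wf_digraph.tail_in_verts[of "with_proj G" "(u, v)"]
      wf_digraph.head_in_verts[of "with_proj G" "(u, v)"] that
    by (simp add: pre_digraph.digraph_isomorphism_def)
  have arc: "iso_arcs f (u, v) = (iso_verts f u, iso_verts f v)" if "(u, v) \<in> parcs G" for u v
    using iso that eqs by (auto simp: pre_digraph.digraph_isomorphism_def prod_eq_iff)
  show "(iso_verts f u, iso_verts f v) \<in> parcs H \<longleftrightarrow> (u, v) \<in> parcs G"
    if "u \<in> pverts G" "v \<in> pverts G" for u v
  proof
    assume "(iso_verts f u, iso_verts f v) \<in> parcs H"
    then obtain p q where "(p, q) \<in> parcs G" "iso_arcs f (p, q) = (iso_verts f u, iso_verts f v)"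
      using eqs(2) by (metis (no_types, opaque_lifting) imageE surj_pair)
    then show "(u, v) \<in> parcs G" using arc wf inj that by (auto simp: inj_on_eq_iff)
  next
    assume "(u, v) \<in> parcs G"
    then show "(iso_verts f u, iso_verts f v) \<in> parcs H" using arc eqs(2) by (metis image_eqI)
  qed
qed

text \<open>The converse passage: \<open>map_prod h h\<close> serves as the arc map.\<close>

lemma with_proj_digraph_isoI:
  assumes wf: "wf_digraph (with_proj G)" "wf_digraph (with_proj H)"
    and bij: "bij_betw h (pverts G) (pverts H)"
    and arcs: "\<And>u v. u \<in> pverts G \<Longrightarrow> v \<in> pverts G \<Longrightarrow> (h u, h v) \<in> parcs H \<longleftrightarrow> (u, v) \<in> parcs G"
  shows "digraph_iso (with_proj G) (with_proj H)"
proof -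
  define f where "f = \<lparr>iso_verts = h, iso_arcs = map_prod h h, iso_head = snd, iso_tail = fst\<rparr>"
  have G: "parcs G \<subseteq> pverts G \<times> pverts G" and H: "parcs H \<subseteq> pverts H \<times> pverts H"
    using wf by (auto simp: wf_digraph_def)
  have inj: "inj_on h (pverts G)" using bij by (simp add: bij_betw_def)
  have "inj_on (map_prod h h) (parcs G)"
    using map_prod_inj_on[OF inj inj] G by (rule inj_on_subset)
  then have "pre_digraph.digraph_isomorphism (with_proj G) f"
    using wf inj by (auto simp: pre_digraph.digraph_isomorphism_def f_def)
  moreover have "map_prod h h ` parcs G = parcs H"
  proof
    show "map_prod h h ` parcs G \<subseteq> parcs H" using arcs G by auto
    show "parcs H \<subseteq> map_prod h h ` parcs G"
    proof
      fix e assume e: "e \<in> parcs H"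
      then have "e \<in> h ` pverts G \<times> h ` pverts G" using H bij by (auto simp: bij_betw_def)
      then obtain u v where "e = (h u, h v)" "u \<in> pverts G" "v \<in> pverts G" by blast
      then show "e \<in> map_prod h h ` parcs G" using e arcs by force
    qed
  qed
  then have "with_proj H = app_iso f (with_proj G)"
    using bij by (simp add: app_iso_def with_proj_def f_def bij_betw_def)
  ultimately show ?thesis unfolding digraph_iso_def by blast
qed

section \<open>Closing the given path\<close>

theorem corollary7p3:
  fixes G P :: "'a pair_pre_digraph"
  assumes "pair_graph G"
    and "pverts G \<noteq> {}"
    and "edge_transitive G"
    and "induced_path 4 P G"
  shows "closes_to_induced_cycle P G"
proof -
  interpret G: pair_graph G by fact
  let ?E = "parcs G"
  have E: "finite ?E" "sym ?E" "irrefl ?E" "?E \<subseteq> pverts G \<times> pverts G"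
    using G.pair_finite_arcs G.pair_sym_arcs G.pair_no_loops[of "(u, u)" for u]
      G.in_arcsD1 G.in_arcsD2
    by (auto simp: symmetric_def irrefl_def)
  have PV: "pverts P \<subseteq> pverts G" and PE: "parcs P = Restr ?E (pverts P)"
    and wfP: "wf_digraph (with_proj P)"
    using \<open>induced_path 4 P G\<close>
    by (auto simp: induced_path_def induced_subgraph_def subgraph_def)
  obtain f where f: "pre_digraph.digraph_isomorphism (with_proj P) f"
    "app_iso f (with_proj P) = with_proj (path_graph 4)"
    using \<open>induced_path 4 P G\<close> unfolding induced_path_def digraph_iso_def by metis
  define k where "k = iso_verts f"
  have k: "bij_betw k (pverts P) {..<4}"
    using with_proj_isomorphismD(1)[OF f] by (simp add: path_graph_def k_def)
  have kE: "(k u, k v) \<in> parcs (path_graph 4) \<longleftrightarrow> (u, v) \<in> parcs P"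
    if "u \<in> pverts P" "v \<in> pverts P" for u v
    using with_proj_isomorphismD(2)[OF f that] by (simp add: k_def)
  \<comment> \<open>\<open>p\<close> lists the vertices of \<open>P\<close> in path order, so the
    middle edge joins \<open>p 1\<close> and \<open>p 2\<close>.\<close>
  define p where "p = inv_into (pverts P) k"
  have p: "p i \<in> pverts P" "k (p i) = i" if "i < 4" for i
    using k that by (auto simp: p_def bij_betw_def inv_into_into f_inv_into_f)
  have pE: "(p i, p j) \<in> ?E \<longleftrightarrow> j = Suc i \<or> i = Suc j" if "i < 4" "j < 4" for i j
    using kE[of "p i" "p j"] p that PE by (auto simp: path_graph_def)
  have "pverts P = p ` {..<4}"
    using bij_betw_imp_surj_on[OF bij_betw_inv_into[OF k]] by (simp add: p_def)
  then have Pverts: "pverts P = {p 0, p 1, p 2, p 3}"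
    by (auto simp: lessThan_nat_numeral lessThan_Suc numeral_3_eq_3 numeral_2_eq_2)
  have P4: "induced_P4 ?E (p 0) (p 1) (p 2) (p 3)" by (simp add: induced_P4_def pE)
  obtain x y where av: "avoidable ?E x y"
    using avoidable_edge_exists[OF E(1,2)] pE[of 0 1] by auto
  then have "(x, y) \<in> ?E" by (simp add: avoidable_def)
  moreover have "(p 1, p 2) \<in> ?E" by (simp add: pE)
  ultimately obtain h where h: "automorphism G h" "{iso_verts h (p 1), iso_verts h (p 2)} = {x, y}"
    using \<open>edge_transitive G\<close> unfolding edge_transitive_def by fast
  \<comment> \<open>\<open>h\<close> may send the middle edge to \<open>xy\<close> in either
    orientation; \<open>avoidable_commute\<close> covers the reversed one.\<close>
  have av_h: "avoidable ?E (iso_verts h (p 1)) (iso_verts h (p 2))"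
    using h(2) av avoidable_commute[OF E(2) av] by (auto simp: doubleton_eq_iff)
  have p12: "p 1 \<in> pverts G" "p 2 \<in> pverts G" using p PV by auto
  have iso: "pre_digraph.digraph_isomorphism (with_proj G) h"
    "app_iso h (with_proj G) = with_proj G"
    using h(1) by (simp_all add: automorphism_def)
  have "avoidable ?E (p 1) (p 2)"
    by (rule avoidable_automorphism[OF with_proj_isomorphismD(1)[OF iso] E(4)
          with_proj_isomorphismD(2)[OF iso] p12 av_h])
  then have "(p 0, p 3) \<in> (Restr ?E ({p 0, p 3} \<union> far ?E (p 1) (p 2)))\<^sup>*"
    using P4 by (auto simp: avoidable_def)
  then obtain n g where n: "n \<ge> 3" and inj: "inj_on g {..<n}"
    and PC: "{p 0, p 1, p 2, p 3} \<subseteq> g ` {..<n}" and gF: "g ` {..<n} \<subseteq> Field ?E"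
    and adj: "\<forall>i<n. \<forall>j<n. (g i, g j) \<in> ?E \<longleftrightarrow> j = Suc i mod n \<or> i = Suc j mod n"
    by (rule induced_cycle_through_P4[OF E(2,3) P4])
  define C where "C = \<lparr>pverts = g ` {..<n}, parcs = Restr ?E (g ` {..<n})\<rparr>"
  have wfG: "wf_digraph (with_proj G)" by unfold_locales
  have wfC: "wf_digraph (with_proj C)" by unfold_locales (auto simp: C_def)
  have "g ` {..<n} \<subseteq> pverts G" using gF E(4) by (auto simp: Field_def)
  then have "induced_subgraph (with_proj C) (with_proj G)"
    using wfC wfG by (auto simp: induced_subgraph_def subgraph_def C_def)
  moreover have "digraph_iso (with_proj C) (with_proj (cycle_graph n))"
  proof (rule with_proj_digraph_isoI)
    show "wf_digraph (with_proj (cycle_graph n))" by unfold_locales (auto simp: cycle_graph_def)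
    show "bij_betw (inv_into {..<n} g) (pverts C) (pverts (cycle_graph n))"
      using inj by (simp add: C_def cycle_graph_def bij_betw_inv_into inj_on_imp_bij_betw)
    show "(inv_into {..<n} g u, inv_into {..<n} g v) \<in> parcs (cycle_graph n) \<longleftrightarrow> (u, v) \<in> parcs C"
      if "u \<in> pverts C" "v \<in> pverts C" for u v
      using that inj adj by (auto simp: C_def cycle_graph_def)
  qed (fact wfC)
  ultimately have "induced_cycle C G" using n by (auto simp: induced_cycle_def)
  \<comment> \<open>Both arc sets are restrictions of \<open>?E\<close>, so containment of the
    vertex sets suffices.\<close>
  moreover have "subgraph (with_proj P) (with_proj C)"
    using wfP wfC PC Pverts PE by (auto simp: subgraph_def C_def)
  ultimately show ?thesis by (auto simp: closes_to_induced_cycle_def)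
qed

end
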